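(* Let $\mathbb{K}$ be $\mathbb{R}$ or $\mathbb{C}$. Let $X$ be a set of infinite cardinality $\kappa$, where $\kappa=\kappa^\omega$. Let $I$ be a subset of $\mathbb{K}$ with nonempty interior in $\mathbb{K}$. Then there exists a free linear subalgebra of $\mathbb{K}^X$ with $2^\kappa$ free generators $\{f_\xi:\xi<2^\kappa\}$ such that, for every $k\geq 1$, every polynomial $P$ in $k$ variables (with coefficients in $\mathbb{K}$) without constant term and any $\xi_1<\xi_2<\dots<\xi_k<2^\kappa$, the function $P(f_{\xi_1},\dots,f_{\xi_k})$ maps $X$ onto $P(I^k)$.
   Context: $\mathbb{K}^X$ is the commutative $\mathbb{K}$-algebra of all functions $X\to\mathbb{K}$ with pointwise operations. Elements $\{f_\xi:\xi<\lambda\}$ (pairwise distinct) are free generators of a free subalgebra if, for every $n\ge 1$, every nonzero polynomial $P$ in $n$ variables over $\mathbb{K}$ without constant term and all distinct indices $\xi_1,\dots,\xi_n$, one has $P(f_{\xi_1},\dots,f_{\xi_n})\neq 0$; the free subalgebra they generate is the set of all such polynomial expressions (polynomials without constant term). *)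

theory Defs
  imports "HOL-Analysis.Analysis" "HOL-Library.Poly_Mapping" "HOL-Library.FuncSet"
begin

unbundle cardinal_syntax

text \<open>
  The algebra of all functions from \<open>X\<close> to the field is carried by the extensional functions
  \<open>X \<rightarrow>\<^sub>E UNIV\<close>, with pointwise operations restricted to \<open>X\<close>.
  A ``linear subalgebra'' is a linear subspace closed under multiplication; it need not contain
  the constant function 1.
\<close>

definition linear_subalgebra :: "'a set \<Rightarrow> ('a \<Rightarrow> 'k::field) set \<Rightarrow> bool" where
  "linear_subalgebra X A \<longleftrightarrow>
     A \<subseteq> X \<rightarrow>\<^sub>E UNIV \<and>
     (\<lambda>x\<in>X. 0) \<in> A \<and>
     (\<forall>g\<in>A. \<forall>h\<in>A. (\<lambda>x\<in>X. g x + h x) \<in> A) \<and>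
     (\<forall>c. \<forall>g\<in>A. (\<lambda>x\<in>X. c * g x) \<in> A) \<and>
     (\<forall>g\<in>A. \<forall>h\<in>A. (\<lambda>x\<in>X. g x * h x) \<in> A)"

text \<open>
  Polynomials are finitely supported maps from monomials to coefficients, where a monomial is a
  finitely supported map from variables to exponents. The \<open>n\<close> variables are numbered
  \<open>0, \<dots>, n - 1\<close>.
\<close>

type_synonym 'k polynomial = "(nat \<Rightarrow>\<^sub>0 nat) \<Rightarrow>\<^sub>0 'k"

definition polys_no_const :: "nat \<Rightarrow> 'k::field polynomial set" where
  "polys_no_const n =
     {P. (\<forall>m\<in>Poly_Mapping.keys P. Poly_Mapping.keys m \<subseteq> {..<n}) \<and> Poly_Mapping.lookup P 0 = 0}"

definition poly_eval :: "'k::field polynomial \<Rightarrow> (nat \<Rightarrow> 'k) \<Rightarrow> 'k" where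
  "poly_eval P y =
     (\<Sum>m\<in>Poly_Mapping.keys P.
        Poly_Mapping.lookup P m * (\<Prod>i\<in>Poly_Mapping.keys m. y i ^ Poly_Mapping.lookup m i))"

text \<open>\<open>P(g\<^sub>0, \<dots>, g\<^sub>n\<^sub>-\<^sub>1)\<close> in the function algebra, whose operations are pointwise.\<close>

definition poly_fun :: "'a set \<Rightarrow> 'k::field polynomial \<Rightarrow> (nat \<Rightarrow> 'a \<Rightarrow> 'k) \<Rightarrow> 'a \<Rightarrow> 'k" where
  "poly_fun X P g = (\<lambda>x\<in>X. poly_eval P (\<lambda>i. g i x))"

definition free_generators :: "'a set \<Rightarrow> 'i set \<Rightarrow> ('i \<Rightarrow> 'a \<Rightarrow> 'k::field) \<Rightarrow> bool" where
  "free_generators X S f \<longleftrightarrow>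
     f \<in> S \<rightarrow> (X \<rightarrow>\<^sub>E UNIV) \<and> inj_on f S \<and>
     (\<forall>n\<ge>1. \<forall>P\<in>polys_no_const n. P \<noteq> 0 \<longrightarrow>
        (\<forall>\<xi>\<in>{..<n} \<rightarrow> S. inj_on \<xi> {..<n} \<longrightarrow>
           poly_fun X P (\<lambda>i. f (\<xi> i)) \<noteq> (\<lambda>x\<in>X. 0)))"

definition poly_expressions :: "'a set \<Rightarrow> 'i set \<Rightarrow> ('i \<Rightarrow> 'a \<Rightarrow> 'k::field) \<Rightarrow> ('a \<Rightarrow> 'k) set" where
  "poly_expressions X S f =
     {poly_fun X P (\<lambda>i. f (\<xi> i)) | n P \<xi>.
        n \<ge> 1 \<and> P \<in> polys_no_const n \<and> \<xi> \<in> {..<n} \<rightarrow> S \<and> inj_on \<xi> {..<n}}"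

definition free_subalgebra ::
  "'a set \<Rightarrow> 'i set \<Rightarrow> ('i \<Rightarrow> 'a \<Rightarrow> 'k::field) \<Rightarrow> ('a \<Rightarrow> 'k) set \<Rightarrow> bool" where
  "free_subalgebra X S f A \<longleftrightarrow>
     linear_subalgebra X A \<and> free_generators X S f \<and> A = poly_expressions X S f"

text \<open>
  \<open>\<xi>\<^sub>0 < \<dots> < \<xi>\<^sub>k\<^sub>-\<^sub>1\<close> with respect to a (reflexive) well-order relation \<open>r\<close>. For a cardinal \<open>r\<close>
  the elements of \<open>Field r\<close>, ordered by \<open>r\<close>, represent the ordinals below \<open>r\<close>.
\<close>

definition increasing_indices :: "'i rel \<Rightarrow> nat \<Rightarrow> (nat \<Rightarrow> 'i) \<Rightarrow> bool" where
  "increasing_indices r k \<xi> \<longleftrightarrow>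
     \<xi> \<in> {..<k} \<rightarrow> Field r \<and>
     (\<forall>i j. i < j \<and> j < k \<longrightarrow> (\<xi> i, \<xi> j) \<in> r \<and> \<xi> i \<noteq> \<xi> j)"

end

theory Submission
  imports Defs
begin

text \<open>
  Generators are indexed by subsets \<open>A\<close> of \<open>X\<close>. Since \<open>\<kappa> = \<kappa>\<^sup>\<omega>\<close> (hence \<open>2\<^sup>\<omega> \<le> \<kappa>\<close>), each point of \<open>X\<close> can code
  a sequence of points \<open>t\<^sub>n \<in> X\<close> together with a sequence of pairs \<open>(B\<^sub>j, v\<^sub>j)\<close> with \<open>B\<^sub>j \<subseteq> \<nat>\<close> and
  \<open>v\<^sub>j \<in> I\<close>. The generator \<open>f\<^sub>A\<close> maps such a point to the value \<open>v\<^sub>j\<close> for the first \<open>j\<close> such that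
  \<open>B\<^sub>j\<close> is the trace \<open>{n. t\<^sub>n \<in> A}\<close>. As finitely many distinct sets are separated by a suitable
  sequence \<open>t\<close>, finitely many generators take arbitrary prescribed values in \<open>I\<close> simultaneously
  at some point. This gives the image of every polynomial expression, and freeness
  follows because a nonzero polynomial cannot vanish on \<open>I\<^sup>k\<close> for infinite \<open>I\<close>.
\<close>

section \<open>Evaluation of monomials and polynomials\<close>

definition monom_eval :: "(nat \<Rightarrow>\<^sub>0 nat) \<Rightarrow> (nat \<Rightarrow> 'k::field) \<Rightarrow> 'k" where
  "monom_eval m y = (\<Prod>i\<in>Poly_Mapping.keys m. y i ^ Poly_Mapping.lookup m i)"

lemma poly_eval_eq_sum_monom_eval:
  "poly_eval P y = (\<Sum>m\<in>Poly_Mapping.keys P. Poly_Mapping.lookup P m * monom_eval m y)"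
  by (simp add: poly_eval_def monom_eval_def)

text \<open>Variables outside the support contribute \<open>y i ^ 0 = 1\<close>. Hence several
  monomials can be evaluated over one common index set; \<open>poly_eval_superset\<close> does the
  same for sums over monomials.\<close>

lemma monom_eval_superset:
  assumes "finite N" "Poly_Mapping.keys m \<subseteq> N"
  shows "monom_eval m y = (\<Prod>i\<in>N. y i ^ Poly_Mapping.lookup m i)"
  unfolding monom_eval_def using assms
  by (intro prod.mono_neutral_left) (auto simp: in_keys_iff)

lemma monom_eval_add: "monom_eval (m + m') y = monom_eval m y * monom_eval m' y"
proof -
  let ?N = "Poly_Mapping.keys m \<union> Poly_Mapping.keys m'"
  have "monom_eval (m + m') y = (\<Prod>i\<in>?N. y i ^ Poly_Mapping.lookup (m + m') i)"
    by (intro monom_eval_superset) (auto simp: in_keys_iff lookup_add)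
  also have "\<dots> = monom_eval m y * monom_eval m' y"
    by (simp add: lookup_add power_add prod.distrib monom_eval_superset[of ?N])
  finally show ?thesis .
qed

lemma monom_eval_single: "monom_eval (Poly_Mapping.single i e) y = y i ^ e"
  by (subst monom_eval_superset[of "{i}"]) (auto split: if_splits)

lemma monom_eval_sum: "monom_eval (sum \<mu> J) y = (\<Prod>j\<in>J. monom_eval (\<mu> j) y)"
  by (induction J rule: infinite_finite_induct) (simp_all add: monom_eval_add, simp_all add: monom_eval_def)

lemma poly_eval_superset:
  assumes "finite M" "Poly_Mapping.keys P \<subseteq> M"
  shows "poly_eval P y = (\<Sum>m\<in>M. Poly_Mapping.lookup P m * monom_eval m y)"
  unfolding poly_eval_eq_sum_monom_eval using assms
  by (intro sum.mono_neutral_left) (auto simp: in_keys_iff)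

lemma poly_eval_add: "poly_eval (P + Q) y = poly_eval P y + poly_eval Q y"
proof -
  let ?M = "Poly_Mapping.keys P \<union> Poly_Mapping.keys Q"
  have "poly_eval (P + Q) y = (\<Sum>m\<in>?M. Poly_Mapping.lookup (P + Q) m * monom_eval m y)"
    by (intro poly_eval_superset) (auto simp: in_keys_iff lookup_add)
  also have "\<dots> = poly_eval P y + poly_eval Q y"
    by (simp add: lookup_add distrib_right sum.distrib poly_eval_superset[of ?M])
  finally show ?thesis .
qed

lemma poly_eval_zero [simp]: "poly_eval 0 y = 0"
  by (simp add: poly_eval_def)

lemma poly_eval_single: "poly_eval (Poly_Mapping.single m c) y = c * monom_eval m y"
  by (subst poly_eval_superset[of "{m}"]) (auto split: if_splits)

lemma poly_eval_sum: "poly_eval (sum p J) y = (\<Sum>j\<in>J. poly_eval (p j) y)"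
  by (induction J rule: infinite_finite_induct) (simp_all add: poly_eval_add)

section \<open>Closure properties of polynomials without constant term\<close>

lemma polys_no_const_zero: "0 \<in> polys_no_const n"
  by (simp add: polys_no_const_def)

lemma polys_no_const_add:
  assumes "P \<in> polys_no_const n" "Q \<in> polys_no_const n"
  shows "P + Q \<in> polys_no_const n"
  using assms Poly_Mapping.keys_add[of P Q]
  unfolding polys_no_const_def by (auto simp: lookup_add)

lemma polys_no_const_sum:
  assumes "\<And>j. j \<in> J \<Longrightarrow> p j \<in> polys_no_const n"
  shows "sum p J \<in> polys_no_const n"
  using assms
  by (induction J rule: infinite_finite_induct)
    (simp_all add: polys_no_const_zero polys_no_const_add)

lemma polys_no_const_single:
  assumes "Poly_Mapping.keys m \<subseteq> {..<n}" "m \<noteq> 0"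
  shows "Poly_Mapping.single m c \<in> polys_no_const n"
  using assms by (auto simp: polys_no_const_def lookup_single split: if_splits)

lemma polys_no_const_monomials:
  assumes "P \<in> polys_no_const n" "m \<in> Poly_Mapping.keys P"
  shows "Poly_Mapping.keys m \<subseteq> {..<n}" "m \<noteq> 0"
  using assms by (auto simp: polys_no_const_def in_keys_iff)

lemma polys_no_const_scale:
  assumes "P \<in> polys_no_const n"
  obtains Q where "Q \<in> polys_no_const n" "\<And>y. poly_eval Q y = c * poly_eval P y"
proof
  \<comment> \<open>As a sum of single terms, \<open>?Q\<close> is evaluated term by term, and
    \<open>c = 0\<close> is no special case.\<close>
  let ?Q = "\<Sum>m\<in>Poly_Mapping.keys P. Poly_Mapping.single m (c * Poly_Mapping.lookup P m)"
  show "?Q \<in> polys_no_const n"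
    using polys_no_const_monomials[OF assms]
    by (intro polys_no_const_sum polys_no_const_single)
  show "poly_eval ?Q y = c * poly_eval P y" for y
    by (simp add: poly_eval_sum poly_eval_single) (simp add: poly_eval_eq_sum_monom_eval sum_distrib_left mult.assoc)
qed

lemma polys_no_const_mult:
  assumes "P \<in> polys_no_const n" "Q \<in> polys_no_const n"
  obtains R where "R \<in> polys_no_const n" "\<And>y. poly_eval R y = poly_eval P y * poly_eval Q y"
proof
  let ?R = "\<Sum>m\<in>Poly_Mapping.keys P. \<Sum>m'\<in>Poly_Mapping.keys Q.
    Poly_Mapping.single (m + m') (Poly_Mapping.lookup P m * Poly_Mapping.lookup Q m')"
  show "?R \<in> polys_no_const n"
  proof (intro polys_no_const_sum polys_no_const_single)
    fix m m' assume m: "m \<in> Poly_Mapping.keys P" "m' \<in> Poly_Mapping.keys Q"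
    show "Poly_Mapping.keys (m + m') \<subseteq> {..<n}"
      using polys_no_const_monomials(1)[OF assms(1) m(1)]
        polys_no_const_monomials(1)[OF assms(2) m(2)] Poly_Mapping.keys_add[of m m'] by blast
    \<comment> \<open>Exponents are natural numbers and cannot cancel, so no constant term
      arises.\<close>
    show "m + m' \<noteq> 0"
      using polys_no_const_monomials(2)[OF assms(1) m(1)]
      by (auto simp: poly_mapping_eq_iff lookup_add fun_eq_iff)
  qed
  show "poly_eval ?R y = poly_eval P y * poly_eval Q y" for y
    by (simp add: poly_eval_sum poly_eval_single monom_eval_add)
      (simp add: poly_eval_eq_sum_monom_eval sum_product algebra_simps)
qed

lemma polys_no_const_rename:
  assumes P: "P \<in> polys_no_const n" and \<sigma>: "\<sigma> \<in> {..<n} \<rightarrow> {..<n'}"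
  obtains Q where "Q \<in> polys_no_const n'" "\<And>y. poly_eval Q y = poly_eval P (\<lambda>i. y (\<sigma> i))"
proof
  \<comment> \<open>The monomial \<open>m\<close> after substituting variable
    \<open>\<sigma> i\<close> for variable \<open>i\<close>: if \<open>\<sigma>\<close> identifies
    variables, their exponents add up.\<close>
  define \<rho> where "\<rho> m = (\<Sum>i\<in>Poly_Mapping.keys m. Poly_Mapping.single (\<sigma> i) (Poly_Mapping.lookup m i))"
    for m :: "nat \<Rightarrow>\<^sub>0 nat"
  let ?Q = "\<Sum>m\<in>Poly_Mapping.keys P. Poly_Mapping.single (\<rho> m) (Poly_Mapping.lookup P m)"
  show "?Q \<in> polys_no_const n'"
  proof (intro polys_no_const_sum polys_no_const_single)
    fix m assume m: "m \<in> Poly_Mapping.keys P"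
    note m' = polys_no_const_monomials[OF P m]
    have "Poly_Mapping.keys (\<rho> m) \<subseteq> \<sigma> ` Poly_Mapping.keys m"
      unfolding \<rho>_def by (auto simp: in_keys_iff lookup_sum lookup_single when_def split: if_splits)
    with m'(1) \<sigma> show "Poly_Mapping.keys (\<rho> m) \<subseteq> {..<n'}" by blast
    from m'(2) obtain i where i: "i \<in> Poly_Mapping.keys m"
      by (metis keys_eq_empty ex_in_conv)
    then have "Poly_Mapping.lookup (\<rho> m) (\<sigma> i) \<noteq> 0"
      unfolding \<rho>_def by (auto simp: lookup_sum in_keys_iff intro!: bexI[of _ i])
    then show "\<rho> m \<noteq> 0" by auto
  qed
  show "poly_eval ?Q y = poly_eval P (\<lambda>i. y (\<sigma> i))" for y
    by (simp add: poly_eval_sum poly_eval_single \<rho>_def monom_eval_sum monom_eval_single)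
      (simp add: poly_eval_def monom_eval_def)
qed

section \<open>Nonvanishing of polynomials on infinite grids\<close>

text \<open>Induction on the number of variables. With the first \<open>n\<close> coordinates fixed
  in \<open>I\<close>, the sum is a univariate polynomial in the last one with infinitely many
  roots, hence zero. Its coefficient at exponent \<open>m0 n\<close> is a vanishing sum over the
  monomials with that last exponent, in one variable fewer. The hypothesis on agreement below
  \<open>n\<close> says that members of \<open>M\<close> stay distinct when cut off to
  \<open>n\<close> variables.\<close>

lemma monomials_independent:
  fixes c :: "(nat \<Rightarrow> nat) \<Rightarrow> 'k::field" and I :: "'k set"
  assumes "infinite I" "finite M"
    and "\<And>m m'. m \<in> M \<Longrightarrow> m' \<in> M \<Longrightarrow> (\<forall>i<n. m i = m' i) \<Longrightarrow> m = m'"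
    and "\<And>y. (\<forall>i<n. y i \<in> I) \<Longrightarrow> (\<Sum>m\<in>M. c m * (\<Prod>i<n. y i ^ m i)) = 0"
    and "m0 \<in> M"
  shows "c m0 = 0"
  using assms(2-)
proof (induction n arbitrary: M)
  case 0
  then have "M = {m0}" by blast
  with 0(3) show ?case by simp
next
  case (Suc n)
  have "(\<Sum>m\<in>{m\<in>M. m n = m0 n}. c m * (\<Prod>i<n. y i ^ m i)) = 0" if y: "\<forall>i<n. y i \<in> I" for y
  proof -
    define p where "p = (\<Sum>m\<in>M. Polynomial.monom (c m * (\<Prod>i<n. y i ^ m i)) (m n))"
    have "poly p z = 0" if z: "z \<in> I" for z
    proof -
      have "poly p z = (\<Sum>m\<in>M. c m * (\<Prod>i<Suc n. (y(n := z)) i ^ m i))"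
        by (simp add: p_def poly_sum poly_monom mult.assoc)
      also have "\<dots> = 0" using y z by (intro Suc.prems(3)) (auto simp: less_Suc_eq)
      finally show ?thesis .
    qed
    then have "infinite {z. poly p z = 0}" using \<open>infinite I\<close> by (meson mem_Collect_eq rev_finite_subset subsetI)
    then have "p = 0" using poly_roots_finite by blast
    then have "0 = poly.coeff p (m0 n)" by simp
    also have "\<dots> = (\<Sum>m\<in>M. if m n = m0 n then c m * (\<Prod>i<n. y i ^ m i) else 0)"
      by (simp add: p_def coeff_sum)
    also have "\<dots> = (\<Sum>m\<in>{m\<in>M. m n = m0 n}. c m * (\<Prod>i<n. y i ^ m i))"
      using Suc.prems(1) by (simp add: sum.inter_filter)
    finally show ?thesis by simp
  qed
  \<comment> \<open>All monomials kept share the exponent at \<open>n\<close>, so agreement below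
    \<open>n\<close> extends to agreement below \<open>Suc n\<close>.\<close>
  moreover have "m = m'" if "m \<in> {m\<in>M. m n = m0 n}" "m' \<in> {m\<in>M. m n = m0 n}" "\<forall>i<n. m i = m' i" for m m'
    using that by (intro Suc.prems(2)) (auto simp: less_Suc_eq)
  ultimately show ?case using Suc.prems(1,4) by (intro Suc.IH[of "{m\<in>M. m n = m0 n}"]) auto
qed

lemma poly_nonzero_on_infinite_grid:
  fixes P :: "'k::field polynomial"
  assumes I: "infinite I" and P: "P \<in> polys_no_const n" and "P \<noteq> 0"
  obtains y where "y \<in> {..<n} \<rightarrow>\<^sub>E I" "poly_eval P y \<noteq> 0"
proof -
  have "\<exists>y\<in>{..<n} \<rightarrow>\<^sub>E I. poly_eval P y \<noteq> 0"
  proof (rule ccontr)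
    assume "\<not> ?thesis"
    then have z: "poly_eval P y = 0" if "y \<in> {..<n} \<rightarrow>\<^sub>E I" for y using that by blast
    from \<open>P \<noteq> 0\<close> obtain m0 where m0: "m0 \<in> Poly_Mapping.keys P"
      by (metis keys_eq_empty ex_in_conv)
    note K = polys_no_const_monomials(1)[OF P]
    \<comment> \<open>This carries the coefficients over to exponent functions; \<open>c\<close> is
      only evaluated at functions of the form \<open>lookup m\<close>, where
      \<open>Abs_poly_mapping\<close> recovers \<open>m\<close>.\<close>
    define c where "c g = Poly_Mapping.lookup P (Abs_poly_mapping g)" for g
    have c: "c (Poly_Mapping.lookup m) = Poly_Mapping.lookup P m" for m
      by (simp add: c_def)
    have "c (Poly_Mapping.lookup m0) = 0"
    proof (rule monomials_independent[OF I, where c = c and n = n and M = "Poly_Mapping.lookup ` Poly_Mapping.keys P"])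
      show "Poly_Mapping.lookup m0 \<in> Poly_Mapping.lookup ` Poly_Mapping.keys P" using m0 by blast
      show "finite (Poly_Mapping.lookup ` Poly_Mapping.keys P)" by simp
    next
      fix g g' assume "g \<in> Poly_Mapping.lookup ` Poly_Mapping.keys P" "g' \<in> Poly_Mapping.lookup ` Poly_Mapping.keys P"
        and eq: "\<forall>i<n. g i = g' i"
      then obtain m m' where m: "g = Poly_Mapping.lookup m" "g' = Poly_Mapping.lookup m'"
        "m \<in> Poly_Mapping.keys P" "m' \<in> Poly_Mapping.keys P" by blast
      show "g = g'"
      proof
        fix i show "g i = g' i"
        proof (cases "i < n")
          case False
          then have "i \<notin> Poly_Mapping.keys m" "i \<notin> Poly_Mapping.keys m'"
            using K[OF m(3)] K[OF m(4)] by auto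
          then show ?thesis by (simp add: m(1,2) in_keys_iff)
        qed (simp add: eq)
      qed
    next
      fix y :: "nat \<Rightarrow> 'k" assume y: "\<forall>i<n. y i \<in> I"
      have inj: "inj_on Poly_Mapping.lookup (Poly_Mapping.keys P)"
        by (simp add: inj_on_def poly_mapping_eqI)
      have "(\<Sum>g\<in>Poly_Mapping.lookup ` Poly_Mapping.keys P. c g * (\<Prod>i<n. y i ^ g i)) =
        (\<Sum>m\<in>Poly_Mapping.keys P. Poly_Mapping.lookup P m * (\<Prod>i<n. y i ^ Poly_Mapping.lookup m i))"
        by (simp add: sum.reindex[OF inj] c)
      \<comment> \<open>The assumption \<open>z\<close> speaks of extensional tuples only;
        restricting \<open>y\<close> is harmless since the monomials of \<open>P\<close> use
        variables below \<open>n\<close>.\<close>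
      also have "\<dots> = (\<Sum>m\<in>Poly_Mapping.keys P. Poly_Mapping.lookup P m * monom_eval m (restrict y {..<n}))"
        by (intro sum.cong refl arg_cong2[where f = "(*)"])
          (subst monom_eval_superset[OF finite_lessThan K], simp_all)
      also have "\<dots> = poly_eval P (restrict y {..<n})" by (simp add: poly_eval_eq_sum_monom_eval)
      also have "\<dots> = 0" using y by (intro z) auto
      finally show "(\<Sum>g\<in>Poly_Mapping.lookup ` Poly_Mapping.keys P. c g * (\<Prod>i<n. y i ^ g i)) = 0" .
    qed
    with m0 show False by (simp add: c in_keys_iff)
  qed
  then show ?thesis using that by blast
qed

section \<open>The subalgebra of polynomial expressions\<close>

lemma poly_eval_cong:
  assumes "P \<in> polys_no_const n" "\<And>i. i < n \<Longrightarrow> y i = z i"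
  shows "poly_eval P y = poly_eval P z"
  unfolding poly_eval_def using polys_no_const_monomials(1)[OF assms(1)] assms(2)
  by (intro sum.cong prod.cong arg_cong2[where f = "(*)"]) (auto simp: subset_iff)

text \<open>The two expressions may involve different generators. An injective enumeration
  \<open>\<zeta>\<close> of the union of both index sets serves both, once the variables of each
  polynomial are renamed accordingly. Pointwise operations on functions then reduce to operations on
  polynomials.\<close>

lemma poly_expressions_common_indices:
  fixes f :: "'i \<Rightarrow> 'a \<Rightarrow> 'k::field"
  assumes "g \<in> poly_expressions X S f" "h \<in> poly_expressions X S f"
  obtains n P Q \<xi> where "n \<ge> 1" "P \<in> polys_no_const n" "Q \<in> polys_no_const n"
    "\<xi> \<in> {..<n} \<rightarrow> S" "inj_on \<xi> {..<n}"
    "g = poly_fun X P (\<lambda>i. f (\<xi> i))" "h = poly_fun X Q (\<lambda>i. f (\<xi> i))"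
proof -
  obtain k P \<xi> where g: "k \<ge> 1" "P \<in> polys_no_const k" "\<xi> \<in> {..<k} \<rightarrow> S"
      "g = poly_fun X P (\<lambda>i. f (\<xi> i))"
    using assms(1) unfolding poly_expressions_def by blast
  obtain l Q \<eta> where h: "l \<ge> 1" "Q \<in> polys_no_const l" "\<eta> \<in> {..<l} \<rightarrow> S"
      "h = poly_fun X Q (\<lambda>i. f (\<eta> i))"
    using assms(2) unfolding poly_expressions_def by blast
  let ?T = "\<xi> ` {..<k} \<union> \<eta> ` {..<l}"
  obtain \<zeta> where \<zeta>: "bij_betw \<zeta> {..<card ?T} ?T"
    using ex_bij_betw_nat_finite[of ?T] by (auto simp: atLeast0LessThan)
  let ?n = "card ?T"
  have reindex: "\<exists>R\<in>polys_no_const ?n. poly_fun X P (\<lambda>i. f (\<xi> i)) = poly_fun X R (\<lambda>i. f (\<zeta> i))"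
    if P: "P \<in> polys_no_const k" and sub: "\<xi> ` {..<k} \<subseteq> ?T" for P :: "'k polynomial" and k \<xi>
  proof -
    have "\<exists>j<?n. \<zeta> j = \<xi> i" if "i < k" for i
    proof -
      have "\<xi> i \<in> \<zeta> ` {..<?n}" using that sub bij_betw_imp_surj_on[OF \<zeta>] by blast
      then show ?thesis by auto
    qed
    then obtain \<sigma> where \<sigma>: "\<And>i. i < k \<Longrightarrow> \<sigma> i < ?n" "\<And>i. i < k \<Longrightarrow> \<zeta> (\<sigma> i) = \<xi> i" by metis
    obtain R where R: "R \<in> polys_no_const ?n" "\<And>y. poly_eval R y = poly_eval P (\<lambda>i. y (\<sigma> i))"
      using polys_no_const_rename[OF P, of \<sigma> ?n] \<sigma>(1) by auto
    have "poly_fun X P (\<lambda>i. f (\<xi> i)) = poly_fun X R (\<lambda>i. f (\<zeta> i))"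
      unfolding poly_fun_def R(2) using \<sigma>(2) by (intro restrict_ext poly_eval_cong[OF P]) simp
    with R(1) show ?thesis by blast
  qed
  obtain P' where P': "P' \<in> polys_no_const ?n" "g = poly_fun X P' (\<lambda>i. f (\<zeta> i))"
    using reindex[OF g(2), of \<xi>] g(4) by blast
  obtain Q' where Q': "Q' \<in> polys_no_const ?n" "h = poly_fun X Q' (\<lambda>i. f (\<zeta> i))"
    using reindex[OF h(2), of \<eta>] h(4) by blast
  have "?T \<subseteq> S" using g(3) h(3) by blast
  then have "\<zeta> \<in> {..<?n} \<rightarrow> S" using bij_betw_imp_surj_on[OF \<zeta>] by blast
  moreover have "?n \<ge> 1" using g(1) by (simp add: Suc_le_eq card_gt_0_iff) force
  ultimately show ?thesis using that P' Q' bij_betw_imp_inj_on[OF \<zeta>] by blast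
qed

lemma linear_subalgebra_poly_expressions:
  fixes f :: "'i \<Rightarrow> 'a \<Rightarrow> 'k::field"
  assumes "S \<noteq> {}"
  shows "linear_subalgebra X (poly_expressions X S f)"
proof -
  have in_expr: "poly_fun X P (\<lambda>i. f (\<xi> i)) \<in> poly_expressions X S f"
    if "n \<ge> 1" "P \<in> polys_no_const n" "\<xi> \<in> {..<n} \<rightarrow> S" "inj_on \<xi> {..<n}" for n P \<xi>
    unfolding poly_expressions_def using that by blast
  \<comment> \<open>The zero function, too, has to be written with at least one variable: the zero
    polynomial at the index \<open>s\<close> does this.\<close>
  obtain s where s: "s \<in> S" using assms by blast
  have zero: "(\<lambda>x\<in>X. 0) \<in> poly_expressions X S f"
    using in_expr[of 1 0 "\<lambda>_. s"] s by (simp add: poly_fun_def polys_no_const_zero inj_on_def)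
  have add: "(\<lambda>x\<in>X. g x + h x) \<in> poly_expressions X S f"
    and mult: "(\<lambda>x\<in>X. g x * h x) \<in> poly_expressions X S f"
    and scale: "(\<lambda>x\<in>X. c * g x) \<in> poly_expressions X S f"
    if gh: "g \<in> poly_expressions X S f" "h \<in> poly_expressions X S f" for g h c
  proof -
    obtain n P Q \<xi> where *: "n \<ge> 1" "P \<in> polys_no_const n" "Q \<in> polys_no_const n"
      "\<xi> \<in> {..<n} \<rightarrow> S" "inj_on \<xi> {..<n}"
      and g: "g = poly_fun X P (\<lambda>i. f (\<xi> i))" and h: "h = poly_fun X Q (\<lambda>i. f (\<xi> i))"
      using poly_expressions_common_indices[OF gh] by blast
    have "(\<lambda>x\<in>X. g x + h x) = poly_fun X (P + Q) (\<lambda>i. f (\<xi> i))"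
      unfolding g h poly_fun_def by (intro restrict_ext) (simp add: poly_eval_add)
    then show "(\<lambda>x\<in>X. g x + h x) \<in> poly_expressions X S f"
      using in_expr[OF *(1) polys_no_const_add[OF *(2,3)] *(4,5)] by simp
    obtain R where R: "R \<in> polys_no_const n" "\<And>y. poly_eval R y = poly_eval P y * poly_eval Q y"
      using polys_no_const_mult[OF *(2,3)] by blast
    have "(\<lambda>x\<in>X. g x * h x) = poly_fun X R (\<lambda>i. f (\<xi> i))"
      unfolding g h poly_fun_def by (intro restrict_ext) (simp add: R(2))
    then show "(\<lambda>x\<in>X. g x * h x) \<in> poly_expressions X S f"
      using in_expr[OF *(1) R(1) *(4,5)] by simp
    obtain R' where R': "R' \<in> polys_no_const n" "\<And>y. poly_eval R' y = c * poly_eval P y"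
      using polys_no_const_scale[OF *(2)] by blast
    have "(\<lambda>x\<in>X. c * g x) = poly_fun X R' (\<lambda>i. f (\<xi> i))"
      unfolding g poly_fun_def by (intro restrict_ext) (simp add: R'(2))
    then show "(\<lambda>x\<in>X. c * g x) \<in> poly_expressions X S f"
      using in_expr[OF *(1) R'(1) *(4,5)] by simp
  qed
  have "poly_expressions X S f \<subseteq> X \<rightarrow>\<^sub>E UNIV"
    unfolding poly_expressions_def poly_fun_def by auto
  with zero show ?thesis
    unfolding linear_subalgebra_def by (intro conjI ballI allI add mult scale)
qed

section \<open>Cardinal arithmetic and an independent family\<close>

text \<open>Characteristic functions give
  \<open>2^\<omega> \<le> \<kappa>^\<omega> = \<kappa>\<close>. This lets points of \<open>X\<close>
  code sets of naturals, and later bounds the size of the scalar field.\<close>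

lemma nat_sets_ordLeq:
  assumes "infinite X" "|X| =o |X| ^c natLeq"
  shows "|UNIV :: nat set set| \<le>o |X|"
proof -
  have "|UNIV :: nat set set| \<le>o ctwo ^c natLeq"
    unfolding cexp_def ctwo_def Field_card_of Field_natLeq
    by (rule card_of_ordLeqI[of "\<lambda>A n. n \<in> A"]) (auto simp: inj_on_def Func_def fun_eq_iff)
  also have "ctwo ^c natLeq \<le>o |X| ^c natLeq"
    using assms(1) by (intro cexp_mono1 ctwo_ordLeq_Cinfinite natLeq_Card_order)
      (simp add: cinfinite_def Field_card_of card_of_card_order_on)
  also have "|X| ^c natLeq =o |X|" using assms(2) by (rule ordIso_symmetric)
  finally show ?thesis .
qed

text \<open>Subsets of \<open>X\<close> appear as Boolean functions with a fixed value outside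
  \<open>X\<close>, the form of the elements of the field of \<open>ctwo ^c |X|\<close>. A point
  codes whole sequences, so even countably many members can be separated and given prescribed values
  at once.\<close>

lemma independent_family:
  fixes X :: "'a set" and I :: "'b set"
  assumes X: "infinite X" "|X| =o |X| ^c natLeq" and I: "I \<noteq> {}" "|I| \<le>o |X|"
  obtains F :: "('a \<Rightarrow> bool) \<Rightarrow> 'a \<Rightarrow> 'b" where "\<And>A x. F A x \<in> I"
    "\<And>T y. T \<subseteq> Func X UNIV \<Longrightarrow> countable T \<Longrightarrow> T \<noteq> {} \<Longrightarrow> y \<in> T \<rightarrow> I \<Longrightarrow> \<exists>x\<in>X. \<forall>A\<in>T. F A x = y A"
proof -
  have "|Func (UNIV :: nat set) X| \<le>o |X|"
    using ordIso_imp_ordLeq[OF ordIso_symmetric[OF X(2)]]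
    by (simp add: cexp_def Field_card_of Field_natLeq)
  moreover have "Func (UNIV :: nat set) X \<noteq> {}" using X(1) by (auto simp: Func_is_emp)
  ultimately obtain D where D: "D ` X = Func (UNIV :: nat set) X"
    using card_of_ordLeq2[of "Func (UNIV :: nat set) X" X] by auto
  have D: "\<exists>x\<in>X. D x = s" if "\<And>n. s n \<in> X" for s :: "nat \<Rightarrow> 'a"
  proof -
    have "s \<in> D ` X" unfolding D using that by (simp add: Func_def)
    then show ?thesis by blast
  qed
  obtain E :: "'a \<Rightarrow> nat set" where E: "E ` X = UNIV"
    using nat_sets_ordLeq[OF X] card_of_ordLeq2[of "UNIV :: nat set set" X] by auto
  obtain V where V: "V ` X = I" using I card_of_ordLeq2[of I X] by auto
  obtain i0 where i0: "i0 \<in> I" using I(1) by blast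
  \<comment> \<open>The sequence \<open>D x\<close> is read at three places: entry 0 codes the
    sample points \<open>t\<close>, entry 1 the traces \<open>B\<close> and entry 2 the values
    \<open>v\<close>. The default \<open>i0\<close> keeps \<open>F\<close> inside \<open>I\<close>
    when a decoded value falls outside, and the choice of \<open>j\<close> is irrelevant
    there.\<close>
  define F where "F A x = (let s = D x; j = (LEAST j. E (D (s 1) j) = {n. A (D (s 0) n)});
    v = V (D (s 2) j) in if v \<in> I then v else i0)" for A x
  show thesis
  proof
    show "F A x \<in> I" for A x using i0 by (simp add: F_def Let_def)
  next
    fix T y assume T: "T \<subseteq> Func X (UNIV :: bool set)" "countable T" "T \<noteq> {}" and y: "y \<in> T \<rightarrow> I"
    have "\<exists>x\<in>X. A \<noteq> B \<longrightarrow> A x \<noteq> B x" if "A \<in> T" "B \<in> T" for A B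
    proof (cases "A = B")
      case True then show ?thesis using X(1) by (metis finite.emptyI ex_in_conv)
    next
      case False
      then obtain x where "A x \<noteq> B x" by blast
      \<comment> \<open>Outside \<open>X\<close> both functions take the same value
        \<open>undefined\<close>.\<close>
      moreover from this have "x \<in> X" using that T(1) unfolding Func_def by (cases "x \<in> X") auto
      ultimately show ?thesis by blast
    qed
    then obtain p where p: "\<And>A B. A \<in> T \<Longrightarrow> B \<in> T \<Longrightarrow> p A B \<in> X"
      "\<And>A B. A \<in> T \<Longrightarrow> B \<in> T \<Longrightarrow> A \<noteq> B \<Longrightarrow> A (p A B) \<noteq> B (p A B)" by metis
    \<comment> \<open>An enumeration of all pairs, possibly with repetitions, so that
      \<open>t\<close> contains a separating point for each pair of distinct members. Hence the
      trace map \<open>\<beta>\<close> below is injective on \<open>T\<close>.\<close>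
    define e where "e = from_nat_into (T \<times> T)"
    have e: "range e = T \<times> T" unfolding e_def using T by (intro range_from_nat_into) auto
    define t where "t n = (case e n of (A, B) \<Rightarrow> p A B)" for n
    have t: "t n \<in> X" for n
    proof -
      have "e n \<in> T \<times> T" using e by blast
      then show ?thesis by (auto simp: t_def p(1))
    qed
    define \<beta> where "\<beta> A = {n. A (t n)}" for A
    have \<beta>: "A = B" if "A \<in> T" "B \<in> T" "\<beta> A = \<beta> B" for A B
    proof (rule ccontr)
      assume "A \<noteq> B"
      have "(A, B) \<in> range e" using e that by blast
      then obtain n where n: "e n = (A, B)" by (metis rangeE)
      have "A (t n) = B (t n)" using that(3) unfolding \<beta>_def by blast
      with p(2)[OF that(1,2) \<open>A \<noteq> B\<close>] n show False by (simp add: t_def)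
    qed
    define a where "a = from_nat_into T"
    have a: "range a = T" unfolding a_def using T by (intro range_from_nat_into) auto
    have "\<exists>x\<in>X. E x = \<beta> (a j)" for j using E by (metis UNIV_I imageE)
    then obtain u where u: "\<And>j. u j \<in> X" "\<And>j. E (u j) = \<beta> (a j)" by metis
    have ya: "y (a j) \<in> I" for j using y a by blast
    then have "\<exists>x\<in>X. V x = y (a j)" for j using V by (metis imageE)
    then obtain w where w: "\<And>j. w j \<in> X" "\<And>j. V (w j) = y (a j)" by metis
    obtain t' where t': "t' \<in> X" "D t' = t" using D[of t, OF t] by blast
    obtain u' where u': "u' \<in> X" "D u' = u" using D[of u, OF u(1)] by blast
    obtain w' where w': "w' \<in> X" "D w' = w" using D[of w, OF w(1)] by blast
    \<comment> \<open>Coding twice: each of the three sequences is a point of \<open>X\<close>, and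
      \<open>x\<close> codes the sequence of these points.\<close>
    obtain x where x: "x \<in> X" "D x = (\<lambda>n. if n = 0 then t' else if n = 1 then u' else w')"
      using D[of "\<lambda>n. if n = 0 then t' else if n = 1 then u' else w'"] t'(1) u'(1) w'(1)
      by (metis (full_types))
    have "F A x = y A" if A: "A \<in> T" for A
    proof -
      \<comment> \<open>The enumeration \<open>a\<close> may repeat, but any index with the trace of
        \<open>A\<close> enumerates \<open>A\<close> itself because \<open>\<beta>\<close> is
        injective, so the least one yields the right value.\<close>
      define j where "j = (LEAST j. \<beta> (a j) = \<beta> A)"
      have "\<exists>j. a j = A" using a A by (metis rangeE)
      then have "\<beta> (a j) = \<beta> A" unfolding j_def by (metis (mono_tags, lifting) LeastI)
      then have "a j = A" using \<beta> a A by blast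
      moreover have "F A x = y (a j)"
        using ya[of j]
        by (simp add: F_def x(2) t'(2) u'(2) w'(2) u(2) w(2) Let_def \<beta>_def[of A, symmetric] j_def[symmetric])
      ultimately show ?thesis by simp
    qed
    with x(1) show "\<exists>x\<in>X. \<forall>A\<in>T. F A x = y A" by blast
  qed
qed

section \<open>Free generators and the images of their polynomial expressions\<close>

text \<open>Common core of the real and complex cases: the nonempty interior of \<open>I\<close>
  enters only through \<open>I\<close> being infinite and of size at most
  \<open>|X|\<close>.\<close>

theorem free_subalgebra_of_independent_family:
  fixes X :: "'a set" and I :: "'k::field set"
  assumes X: "infinite X" "|X| =o |X| ^c natLeq" and I: "infinite I" "|I| \<le>o |X|"
  shows "\<exists>A f. free_subalgebra X (Field (ctwo ^c |X| )) f A \<and>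
           (\<forall>k\<ge>1. \<forall>P\<in>polys_no_const k. \<forall>\<xi>. increasing_indices (ctwo ^c |X| ) k \<xi> \<longrightarrow>
              poly_fun X P (\<lambda>i. f (\<xi> i)) ` X = poly_eval P ` ({..<k} \<rightarrow>\<^sub>E I))"
proof -
  let ?S = "Field (ctwo ^c |X| )"
  have S: "?S = Func X UNIV" by (simp add: cexp_def ctwo_def Field_card_of)
  have "I \<noteq> {}" using I(1) by auto
  then obtain F :: "('a \<Rightarrow> bool) \<Rightarrow> 'a \<Rightarrow> 'k" where FI: "\<And>A x. F A x \<in> I"
    and F: "\<And>T y. T \<subseteq> ?S \<Longrightarrow> countable T \<Longrightarrow> T \<noteq> {} \<Longrightarrow> y \<in> T \<rightarrow> I \<Longrightarrow> \<exists>x\<in>X. \<forall>A\<in>T. F A x = y A"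
    using independent_family[OF X _ I(2)] unfolding S by metis
  define f where "f A = restrict (F A) X" for A
  have onto: "\<exists>x\<in>X. \<forall>i<k. f (\<xi> i) x = y i"
    if "k \<ge> 1" "\<xi> \<in> {..<k} \<rightarrow> ?S" "inj_on \<xi> {..<k}" "y \<in> {..<k} \<rightarrow> I" for k :: nat and \<xi> y
  proof -
    \<comment> \<open>Turns values attached to positions into values attached to generators, using
      that \<open>\<xi>\<close> is injective.\<close>
    let ?y = "\<lambda>A. y (inv_into {..<k} \<xi> A)"
    have "\<exists>x\<in>X. \<forall>A\<in>\<xi> ` {..<k}. F A x = ?y A"
      using that by (intro F) (auto simp: inv_into_f_f lessThan_empty_iff)
    then show ?thesis using that(3) by (auto simp: f_def inv_into_f_f)
  qed
  \<comment> \<open>Proved for injective index tuples, as freeness refers to these; increasing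
    tuples are a special case.\<close>
  have image: "poly_fun X P (\<lambda>i. f (\<xi> i)) ` X = poly_eval P ` ({..<k} \<rightarrow>\<^sub>E I)"
    if k: "k \<ge> 1" and P: "P \<in> polys_no_const k" and \<xi>: "\<xi> \<in> {..<k} \<rightarrow> ?S" "inj_on \<xi> {..<k}"
    for k P \<xi>
  proof (intro equalityI subsetI)
    fix z assume "z \<in> poly_fun X P (\<lambda>i. f (\<xi> i)) ` X"
    then obtain x where x: "x \<in> X" "z = poly_eval P (\<lambda>i. f (\<xi> i) x)"
      by (auto simp: poly_fun_def)
    have "z = poly_eval P (\<lambda>i\<in>{..<k}. f (\<xi> i) x)"
      unfolding x(2) by (rule poly_eval_cong[OF P]) simp
    moreover have "(\<lambda>i\<in>{..<k}. f (\<xi> i) x) \<in> {..<k} \<rightarrow>\<^sub>E I" using x(1) FI by (auto simp: f_def)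
    ultimately show "z \<in> poly_eval P ` ({..<k} \<rightarrow>\<^sub>E I)" by blast
  next
    fix z assume "z \<in> poly_eval P ` ({..<k} \<rightarrow>\<^sub>E I)"
    then obtain y where y: "y \<in> {..<k} \<rightarrow>\<^sub>E I" "z = poly_eval P y" by blast
    obtain x where x: "x \<in> X" "\<forall>i<k. f (\<xi> i) x = y i"
      using onto[OF k \<xi>, of y] y(1) by (auto simp: PiE_def)
    have "z = poly_fun X P (\<lambda>i. f (\<xi> i)) x"
      using x poly_eval_cong[OF P, of "\<lambda>i. f (\<xi> i) x" y] by (simp add: poly_fun_def y(2))
    with x(1) show "z \<in> poly_fun X P (\<lambda>i. f (\<xi> i)) ` X" by blast
  qed
  have "free_generators X ?S f"
    unfolding free_generators_def
  proof (intro conjI allI ballI impI)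
    show "f \<in> ?S \<rightarrow> (X \<rightarrow>\<^sub>E UNIV)" by (auto simp: f_def)
    obtain a where a: "a \<in> I" using \<open>I \<noteq> {}\<close> by blast
    moreover have "\<not> I \<subseteq> {a}" using I(1) finite_subset by blast
    \<comment> \<open>Prescribing two different values for two distinct indices will show that their
      generators differ.\<close>
    ultimately obtain b where ab: "a \<in> I" "b \<in> I" "a \<noteq> b" by blast
    show "inj_on f ?S"
    proof (rule inj_onI, rule ccontr)
      fix A B assume AB: "A \<in> ?S" "B \<in> ?S" "f A = f B" "A \<noteq> B"
      have "\<exists>x\<in>X. \<forall>C\<in>{A, B}. F C x = (if C = A then a else b)"
        using AB ab by (intro F) auto
      then obtain x where x: "x \<in> X" "F A x \<noteq> F B x" using AB(4) ab(3) by auto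
      have "f A x = f B x" by (simp add: AB(3))
      with x show False by (simp add: f_def)
    qed
  next
    fix n P \<xi> assume n: "n \<ge> 1" "P \<in> polys_no_const n" "P \<noteq> (0 :: 'k polynomial)"
      "\<xi> \<in> {..<n} \<rightarrow> ?S" "inj_on \<xi> {..<n}"
    obtain y where y: "y \<in> {..<n} \<rightarrow>\<^sub>E I" "poly_eval P y \<noteq> 0"
      using poly_nonzero_on_infinite_grid[OF I(1) n(2,3)] by blast
    \<comment> \<open>Freeness follows from the image formula: a nonzero value of \<open>P\<close>
      on the grid is attained by the function on \<open>X\<close>.\<close>
    then have "poly_eval P y \<in> poly_fun X P (\<lambda>i. f (\<xi> i)) ` X"
      using image[OF n(1,2,4,5)] by blast
    with y(2) show "poly_fun X P (\<lambda>i. f (\<xi> i)) \<noteq> (\<lambda>x\<in>X. 0)" by auto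
  qed
  moreover have "?S \<noteq> {}" by (simp add: S Func_is_emp)
  ultimately have "free_subalgebra X ?S f (poly_expressions X ?S f)"
    unfolding free_subalgebra_def by (simp add: linear_subalgebra_poly_expressions)
  moreover have "\<xi> \<in> {..<k} \<rightarrow> ?S \<and> inj_on \<xi> {..<k}" if "increasing_indices (ctwo ^c |X| ) k \<xi>" for k \<xi>
    using that unfolding increasing_indices_def inj_on_def by (metis lessThan_iff linorder_neqE_nat)
  ultimately show ?thesis
    using image by (intro exI[of _ "poly_expressions X ?S f"] exI[of _ f]) simp
qed

section \<open>Real and complex scalars\<close>

theorem theorem2p1:
  fixes X :: "'a set"
  assumes "infinite X"
    and "|X| =o |X| ^c natLeq"
  shows
    "(\<forall>I :: real set. interior I \<noteq> {} \<longrightarrow>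
        (\<exists>A f. free_subalgebra X (Field (ctwo ^c |X| )) f A \<and>
           (\<forall>k\<ge>1. \<forall>P\<in>polys_no_const k. \<forall>\<xi>. increasing_indices (ctwo ^c |X| ) k \<xi> \<longrightarrow>
              poly_fun X P (\<lambda>i. f (\<xi> i)) ` X = poly_eval P ` ({..<k} \<rightarrow>\<^sub>E I)))) \<and>
     (\<forall>I :: complex set. interior I \<noteq> {} \<longrightarrow>
        (\<exists>A f. free_subalgebra X (Field (ctwo ^c |X| )) f A \<and>
           (\<forall>k\<ge>1. \<forall>P\<in>polys_no_const k. \<forall>\<xi>. increasing_indices (ctwo ^c |X| ) k \<xi> \<longrightarrow>
              poly_fun X P (\<lambda>i. f (\<xi> i)) ` X = poly_eval P ` ({..<k} \<rightarrow>\<^sub>E I))))"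
proof -
  have "|UNIV :: real set| =o |UNIV :: nat set set|"
    using nat_sets_eqpoll_reals unfolding eqpoll_iff_card_of_ordIso by (rule ordIso_symmetric)
  then have real: "|UNIV :: real set| \<le>o |X|"
    by (rule ordIso_ordLeq_trans[OF _ nat_sets_ordLeq[OF assms]])
  have "|UNIV :: complex set| \<le>o |(UNIV :: real set) \<times> (UNIV :: real set)|"
    by (rule card_of_ordLeqI[of "\<lambda>z. (Re z, Im z)"]) (auto simp: inj_on_def complex_eq_iff)
  also have "|(UNIV :: real set) \<times> (UNIV :: real set)| =o |UNIV :: real set|"
    by (rule card_of_Times_same_infinite) (simp add: infinite_UNIV_char_0)
  finally have complex: "|UNIV :: complex set| \<le>o |X|"
    by (rule ordLeq_transitive[OF _ real])
  \<comment> \<open>Finite sets have empty interior, and \<open>I\<close> is no larger than the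
    field, whose size is bounded by that of \<open>X\<close>.\<close>
  have real_sets: "infinite I" "|I| \<le>o |X|" if "interior I \<noteq> {}" for I :: "real set"
    using that empty_interior_finite[of I] ordLeq_transitive[OF card_of_mono1[OF subset_UNIV] real]
    by auto
  have complex_sets: "infinite I" "|I| \<le>o |X|" if "interior I \<noteq> {}" for I :: "complex set"
    using that empty_interior_finite[of I] ordLeq_transitive[OF card_of_mono1[OF subset_UNIV] complex]
    by auto
  show ?thesis
    using free_subalgebra_of_independent_family[OF assms real_sets]
      free_subalgebra_of_independent_family[OF assms complex_sets]
    by (intro conjI allI impI)
qed

end
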